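(* Let $X$ be an infinite dimensional separable real Hilbert space with orthonormal basis $\{u^{(k)}\}_{k\in\mathbb{N}}$, let $Y$ be an infinite dimensional real Banach space, let $\widetilde A\colon X\to Y$ be an injective bounded linear operator, and let $A\colon\ell^1\to Y$ be given by $Ax=\widetilde A\bigl(\sum_{k=1}^\infty x_k u^{(k)}\bigr)$. Then the equation $Ax=y$, $x\in\ell^1$, is always ill-posed of type II.
   Context: $\ell^1$ is the Banach space of absolutely summable real sequences $x=(x_k)_{k\in\mathbb{N}}$. For an injective bounded linear operator $B\colon Z_1\to Z_2$ between infinite dimensional Banach spaces, the equation $Bx=y$ is called well-posed if the range $\mathcal{R}(B)$ is a closed subset of $Z_2$, and ill-posed if the range is not closed. In the ill-posed case, the equation is called ill-posed of type I if $\mathcal{R}(B)$ contains an infinite dimensional closed subspace (closed in $Z_2$), and ill-posed of type II otherwise. *)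

theory Defs
  imports "HOL-Analysis.Analysis"
begin

section \<open>The Banach space of absolutely summable real sequences\<close>

typedef ell1 = "{x :: nat \<Rightarrow> real. summable (\<lambda>k. \<bar>x k\<bar>)}"
  morphisms ell1_nth Abs_ell1
  by (rule exI[of _ "\<lambda>_. 0"]) simp

setup_lifting type_definition_ell1

lemma summable_ell1: "summable (\<lambda>k. \<bar>ell1_nth x k\<bar>)"
  using ell1_nth by auto

lemma ell1_eqI: "(\<And>k. ell1_nth x k = ell1_nth y k) \<Longrightarrow> x = y"
  by (simp add: ell1_nth_inject[symmetric] fun_eq_iff)

lemma summable_ell1_aux:
  fixes x y z :: "nat \<Rightarrow> real"
  assumes "summable (\<lambda>k. \<bar>x k\<bar>)" "summable (\<lambda>k. \<bar>y k\<bar>)" "\<And>k. \<bar>z k\<bar> \<le> \<bar>x k\<bar> + \<bar>y k\<bar>"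
  shows "summable (\<lambda>k. \<bar>z k\<bar>)"
  by (rule summable_comparison_test'[OF summable_add[OF assms(1,2)]]) (use assms(3) in auto)

instantiation ell1 :: real_normed_vector
begin

lift_definition zero_ell1 :: ell1 is "\<lambda>_. 0" by simp

lift_definition plus_ell1 :: "ell1 \<Rightarrow> ell1 \<Rightarrow> ell1" is "\<lambda>x y k. x k + y k"
  by (erule (1) summable_ell1_aux, arith)

lift_definition uminus_ell1 :: "ell1 \<Rightarrow> ell1" is "\<lambda>x k. - x k" by simp

lift_definition minus_ell1 :: "ell1 \<Rightarrow> ell1 \<Rightarrow> ell1" is "\<lambda>x y k. x k - y k"
  by (erule (1) summable_ell1_aux, arith)

lift_definition scaleR_ell1 :: "real \<Rightarrow> ell1 \<Rightarrow> ell1" is "\<lambda>c x k. c * x k"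
  by (simp add: abs_mult summable_mult)

lift_definition norm_ell1 :: "ell1 \<Rightarrow> real" is "\<lambda>x. \<Sum>k. \<bar>x k\<bar>" .

definition dist_ell1 :: "ell1 \<Rightarrow> ell1 \<Rightarrow> real"
  where "dist_ell1 x y = norm (x - y)"

definition sgn_ell1 :: "ell1 \<Rightarrow> ell1"
  where "sgn_ell1 x = inverse (norm x) *\<^sub>R x"

definition uniformity_ell1 :: "(ell1 \<times> ell1) filter"
  where "uniformity_ell1 = (INF e\<in>{0<..}. principal {(x, y). dist x y < e})"

definition open_ell1 :: "ell1 set \<Rightarrow> bool"
  where "open_ell1 U \<longleftrightarrow> (\<forall>x\<in>U. eventually (\<lambda>(x', y). x' = x \<longrightarrow> y \<in> U) uniformity)"

instance
proof
  fix x y z :: ell1 and a b :: real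
  show "x + y + z = x + (y + z)" by transfer auto
  show "x + y = y + x" by transfer auto
  show "0 + x = x" by transfer auto
  show "- x + x = 0" by transfer auto
  show "x - y = x + - y" by transfer auto
  show "a *\<^sub>R (x + y) = a *\<^sub>R x + a *\<^sub>R y" by transfer (auto simp: algebra_simps)
  show "(a + b) *\<^sub>R x = a *\<^sub>R x + b *\<^sub>R x" by transfer (auto simp: algebra_simps)
  show "a *\<^sub>R b *\<^sub>R x = (a * b) *\<^sub>R x" by transfer (auto simp: algebra_simps)
  show "1 *\<^sub>R x = x" by transfer auto
  show "dist x y = norm (x - y)" by (rule dist_ell1_def)
  show "sgn x = inverse (norm x) *\<^sub>R x" by (rule sgn_ell1_def)
  show "(uniformity :: (ell1 \<times> ell1) filter) = (INF e\<in>{0<..}. principal {(x, y). dist x y < e})"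
    by (rule uniformity_ell1_def)
  show "open U \<longleftrightarrow> (\<forall>x\<in>U. eventually (\<lambda>(x', y). x' = x \<longrightarrow> y \<in> U) uniformity)"
    for U :: "ell1 set" by (rule open_ell1_def)
  show "norm x = 0 \<longleftrightarrow> x = 0"
    by transfer (auto simp: suminf_eq_zero_iff)
  show "norm (x + y) \<le> norm x + norm y"
  proof -
    have "norm (x + y) \<le> (\<Sum>k. \<bar>ell1_nth x k\<bar> + \<bar>ell1_nth y k\<bar>)"
      using summable_ell1[of "x + y"] unfolding norm_ell1.rep_eq
      by (intro suminf_le summable_add summable_ell1) (auto simp: plus_ell1.rep_eq)
    then show ?thesis
      by (simp add: norm_ell1.rep_eq suminf_add[OF summable_ell1 summable_ell1])
  qed
  show "norm (a *\<^sub>R x) = \<bar>a\<bar> * norm x"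
    by transfer (auto simp: abs_mult suminf_mult)
qed

end

lemma sum_abs_le_norm_ell1: "(\<Sum>k<n. \<bar>ell1_nth x k\<bar>) \<le> norm x"
  unfolding norm_ell1.rep_eq by (rule sum_le_suminf[OF summable_ell1]) auto

lemma abs_ell1_nth_le_norm: "\<bar>ell1_nth x k\<bar> \<le> norm x"
proof -
  have "\<bar>ell1_nth x k\<bar> \<le> (\<Sum>j<Suc k. \<bar>ell1_nth x j\<bar>)"
    by (rule member_le_sum) auto
  also have "\<dots> \<le> norm x" by (rule sum_abs_le_norm_ell1)
  finally show ?thesis .
qed

instance ell1 :: banach
proof
  fix X :: "nat \<Rightarrow> ell1"
  assume X: "Cauchy X"
  have "Cauchy (\<lambda>n. ell1_nth (X n) k)" for k
  proof (rule CauchyI)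
    fix e :: real assume "e > 0"
    with X obtain M where M: "\<And>m n. m \<ge> M \<Longrightarrow> n \<ge> M \<Longrightarrow> norm (X m - X n) < e"
      by (meson CauchyD)
    have "norm (ell1_nth (X m) k - ell1_nth (X n) k) < e" if "m \<ge> M" "n \<ge> M" for m n
      using M[OF that] abs_ell1_nth_le_norm[of "X m - X n" k] by (simp add: minus_ell1.rep_eq)
    then show "\<exists>M. \<forall>m\<ge>M. \<forall>n\<ge>M. norm (ell1_nth (X m) k - ell1_nth (X n) k) < e" by blast
  qed
  then have "\<forall>k. \<exists>l. (\<lambda>n. ell1_nth (X n) k) \<longlonglongrightarrow> l"
    by (simp add: Cauchy_convergent_iff convergent_def)
  then obtain l where l: "\<And>k. (\<lambda>n. ell1_nth (X n) k) \<longlonglongrightarrow> l k" by metis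
  have tail: "\<exists>M. \<forall>m\<ge>M. summable (\<lambda>k. \<bar>ell1_nth (X m) k - l k\<bar>)
      \<and> (\<Sum>k. \<bar>ell1_nth (X m) k - l k\<bar>) \<le> e" if "e > 0" for e
  proof -
    from X that obtain M where M: "\<And>m n. m \<ge> M \<Longrightarrow> n \<ge> M \<Longrightarrow> norm (X m - X n) < e"
      by (meson CauchyD)
    have "summable (\<lambda>k. \<bar>ell1_nth (X m) k - l k\<bar>)
        \<and> (\<Sum>k. \<bar>ell1_nth (X m) k - l k\<bar>) \<le> e" if m: "m \<ge> M" for m
    proof -
      have le: "(\<Sum>k<K. \<bar>ell1_nth (X m) k - l k\<bar>) \<le> e" for K
      proof (rule LIMSEQ_le_const2)
        show "(\<lambda>n. \<Sum>k<K. \<bar>ell1_nth (X m) k - ell1_nth (X n) k\<bar>)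
            \<longlonglongrightarrow> (\<Sum>k<K. \<bar>ell1_nth (X m) k - l k\<bar>)"
          by (intro tendsto_intros l)
        have "(\<Sum>k<K. \<bar>ell1_nth (X m) k - ell1_nth (X n) k\<bar>) \<le> e" if "n \<ge> M" for n
          using M[OF m that] sum_abs_le_norm_ell1[of "X m - X n" K]
          by (simp add: minus_ell1.rep_eq)
        then show "\<exists>N. \<forall>n\<ge>N. (\<Sum>k<K. \<bar>ell1_nth (X m) k - ell1_nth (X n) k\<bar>) \<le> e" by blast
      qed
      have s: "summable (\<lambda>k. \<bar>ell1_nth (X m) k - l k\<bar>)"
        by (rule summableI_nonneg_bounded[OF _ le]) auto
      with le show ?thesis by (auto intro: suminf_le_const)
    qed
    then show ?thesis by blast
  qed
  obtain M where M: "summable (\<lambda>k. \<bar>ell1_nth (X M) k - l k\<bar>)"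
    using tail[of 1] by auto
  have "summable (\<lambda>k. \<bar>l k\<bar>)"
    by (rule summable_comparison_test'[OF summable_add[OF M summable_ell1[of "X M"]]]) auto
  then have L: "ell1_nth (Abs_ell1 l) = l" by (simp add: Abs_ell1_inverse)
  have "X \<longlonglongrightarrow> Abs_ell1 l"
  proof (rule LIMSEQ_I)
    fix r :: real assume "r > 0"
    then obtain N where N: "\<forall>m\<ge>N. (\<Sum>k. \<bar>ell1_nth (X m) k - l k\<bar>) \<le> r / 2"
      using tail[of "r / 2"] by auto
    have "norm (X m - Abs_ell1 l) < r" if "m \<ge> N" for m
    proof -
      have "norm (X m - Abs_ell1 l) = (\<Sum>k. \<bar>ell1_nth (X m) k - l k\<bar>)"
        by (simp add: norm_ell1.rep_eq minus_ell1.rep_eq L)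
      with N that \<open>r > 0\<close> show ?thesis by fastforce
    qed
    then show "\<exists>N. \<forall>m\<ge>N. norm (X m - Abs_ell1 l) < r" by blast
  qed
  then show "convergent X" by (auto simp: convergent_def)
qed

section \<open>Hilbert and Banach space notions\<close>

definition infinite_dimensional :: "'a::real_vector set \<Rightarrow> bool"
  where "infinite_dimensional V \<longleftrightarrow> \<not> (\<exists>S. finite S \<and> span S = V)"

definition orthonormal_basis :: "(nat \<Rightarrow> 'a::real_inner) \<Rightarrow> bool"
  where "orthonormal_basis u \<longleftrightarrow>
    (\<forall>i j. u i \<bullet> u j = (if i = j then 1 else 0)) \<and> closure (span (range u)) = UNIV"

lemma summable_ell1_orthonormal_basis:
  fixes u :: "nat \<Rightarrow> 'a::{real_inner, banach}"
  assumes "orthonormal_basis u"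
  shows "summable (\<lambda>k. ell1_nth x k *\<^sub>R u k)"
proof (rule summable_norm_cancel)
  have "norm (u k) = 1" for k
    using assms by (simp add: orthonormal_basis_def norm_eq_sqrt_inner)
  then show "summable (\<lambda>k. norm (ell1_nth x k *\<^sub>R u k))"
    by (simp add: summable_ell1)
qed

section \<open>Well-posedness and ill-posedness of \<open>B x = y\<close>\<close>

text \<open>Well-posedness and both types of ill-posedness are declared only for injective bounded
  linear operators between infinite dimensional Banach spaces. This standing requirement is part
  of each predicate, so that \<open>ill_posed B\<close> is not the mere negation of \<open>well_posed B\<close>.\<close>

definition injective_operator :: "('a::banach \<Rightarrow> 'b::banach) \<Rightarrow> bool"
  where "injective_operator B \<longleftrightarrow>
    infinite_dimensional (UNIV :: 'a set) \<and> infinite_dimensional (UNIV :: 'b set) \<and>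
    bounded_linear B \<and> inj B"

definition well_posed :: "('a::banach \<Rightarrow> 'b::banach) \<Rightarrow> bool"
  where "well_posed B \<longleftrightarrow> injective_operator B \<and> closed (range B)"

definition ill_posed :: "('a::banach \<Rightarrow> 'b::banach) \<Rightarrow> bool"
  where "ill_posed B \<longleftrightarrow> injective_operator B \<and> \<not> closed (range B)"

definition ill_posed_type_I :: "('a::banach \<Rightarrow> 'b::banach) \<Rightarrow> bool"
  where "ill_posed_type_I B \<longleftrightarrow> ill_posed B \<and>
    (\<exists>V. V \<subseteq> range B \<and> subspace V \<and> closed V \<and> infinite_dimensional V)"

definition ill_posed_type_II :: "('a::banach \<Rightarrow> 'b::banach) \<Rightarrow> bool"
  where "ill_posed_type_II B \<longleftrightarrow> ill_posed B \<and> \<not> ill_posed_type_I B"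

end

theory Submission
  imports Defs
begin

text \<open>Let \<open>V\<close> be a closed subspace of the range of \<open>A\<close>. Since the given operator on the Hilbert
  space is injective, the preimage \<open>U\<close> of \<open>V\<close> under it is a closed subspace consisting of
  elements with absolutely summable coefficients, so by uniform boundedness the \<open>\<ell>\<^sup>1\<close>-norm is
  dominated by the Hilbert norm on \<open>U\<close>: \<open>\<parallel>x\<parallel>\<^sub>1 \<le> C \<parallel>x\<parallel>\<^sub>2\<close>. If \<open>V\<close> were infinite dimensional, then so would be
  \<open>U\<close>, and sums of almost disjointly supported unit vectors would have bounded coefficients
  but arbitrarily large \<open>\<ell>\<^sup>1\<close>-norm, contradicting
  \<open>\<parallel>x\<parallel>\<^sub>1\<^sup>2 \<le> C\<^sup>2 \<parallel>x\<parallel>\<^sub>2\<^sup>2 \<le> C\<^sup>2 \<parallel>x\<parallel>\<^sub>\<infinity> \<parallel>x\<parallel>\<^sub>1\<close>. Taking for \<open>V\<close> the whole range shows that the range is not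
  closed.\<close>

section \<open>Uniform boundedness for seminorms\<close>

text \<open>Baire's theorem in the complete space \<open>U\<close>: the closed sublevel sets
  \<open>F n\<close> cover \<open>U\<close>, so one of them contains a relative ball, and
  translating and rescaling this ball gives a bound uniform in \<open>m\<close>.\<close>

lemma uniform_boundedness_on_subspace:
  fixes p :: "nat \<Rightarrow> 'a::banach \<Rightarrow> real"
  assumes U: "subspace U" "closed U"
    and cont: "\<And>m. continuous_on U (p m)"
    and triangle: "\<And>m x y. p m (x + y) \<le> p m x + p m y"
    and scale: "\<And>m c x. p m (c *\<^sub>R x) = \<bar>c\<bar> * p m x"
    and bdd: "\<And>x. x \<in> U \<Longrightarrow> bdd_above (range (\<lambda>m. p m x))"
  obtains C where "\<And>m x. x \<in> U \<Longrightarrow> p m x \<le> C * norm x"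
proof -
  define F where "F n = {x \<in> U. \<forall>m. p m x \<le> real n}" for n :: nat
  have closedin: "closedin (top_of_set U) (F n)" for n
  proof -
    have "closedin (top_of_set U) (\<Inter>m. U \<inter> p m -` {..real n})"
      by (intro closedin_INT continuous_closedin_preimage cont closed_atMost) simp
    also have "(\<Inter>m. U \<inter> p m -` {..real n}) = F n"
      by (auto simp: F_def)
    finally show ?thesis .
  qed
  have "\<Union>(range F) = U"
  proof -
    have "\<exists>n. x \<in> F n" if "x \<in> U" for x
    proof -
      obtain B where "\<And>m. p m x \<le> B"
        using bdd[OF \<open>x \<in> U\<close>] by (auto simp: bdd_above_def)
      moreover obtain n where "B \<le> real n"
        using real_arch_simple by blast
      ultimately have "p m x \<le> real n" for m
        by (meson order_trans)
      then show ?thesis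
        using \<open>x \<in> U\<close> by (auto simp: F_def)
    qed
    then show ?thesis by (auto simp: F_def)
  qed
  moreover have "0 \<in> U"
    using U(1) by (rule subspace_0)
  ultimately have "top_of_set U interior_of \<Union>(range F) \<noteq> {}"
    using interior_of_topspace[of "top_of_set U"] by auto
  moreover have "completely_metrizable_space (top_of_set U)"
    using U(2) by (simp add: completely_metrizable_space_closedin completely_metrizable_space_euclidean)
  ultimately obtain n where "top_of_set U interior_of F n \<noteq> {}"
    using Baire_category_alt[of "top_of_set U" "range F"] closedin by auto
  then obtain T z where "openin (top_of_set U) T" "z \<in> T" "T \<subseteq> F n"
    by (auto simp: interior_of_def)
  then obtain e where e: "e > 0" "ball z e \<inter> U \<subseteq> F n" and z: "z \<in> U"
    by (metis openin_contains_ball order_trans subsetD openin_imp_subset)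
  have "p m x \<le> 4 * real n / e * norm x" if x: "x \<in> U" for m x
  proof (cases "x = 0")
    case True
    then show ?thesis using scale[of m 0 0] by simp
  next
    case False
    \<comment> \<open>This scaling gives \<open>c *\<^sub>R x\<close> norm \<open>e / 2\<close>, so
      \<open>z + c *\<^sub>R x\<close> stays in the ball; dividing \<open>2 * real n\<close> by
      \<open>c\<close> yields the constant \<open>4 * real n / e\<close>.\<close>
    define c where "c = e / (2 * norm x)"
    have c: "c > 0" using False e by (simp add: c_def)
    have "norm (c *\<^sub>R x) < e"
      using False e by (simp add: c_def)
    then have "z + c *\<^sub>R x \<in> ball z e \<inter> U"
      using z x U(1) by (simp add: dist_norm subspace_add subspace_scale)
    then have 1: "p m (z + c *\<^sub>R x) \<le> real n"
      using e(2) by (auto simp: F_def)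
    have 2: "p m z \<le> real n"
      using e z by (auto simp: F_def subset_iff)
    have "p m (c *\<^sub>R x) \<le> p m (z + c *\<^sub>R x) + p m ((-1) *\<^sub>R z)"
      using triangle[of m "z + c *\<^sub>R x" "(-1) *\<^sub>R z"] by simp
    also have "\<dots> \<le> 2 * real n"
      using 1 2 by (simp only: scale)
    finally have "c * p m x \<le> 2 * real n"
      using c by (simp add: scale)
    then show ?thesis
      using c e False by (simp add: c_def field_simps)
  qed
  then show thesis by (rule that)
qed

section \<open>Infinite dimensional subspaces\<close>

text \<open>One functional lowers the dimension by at most one: a finite spanning set of the smaller
  kernel, enlarged by one vector outside it, would span the larger kernel.\<close>

lemma infinite_dimensional_kernel:
  fixes f :: "nat \<Rightarrow> 'a::real_vector \<Rightarrow> real"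
  assumes W: "subspace W" "infinite_dimensional W" and f: "\<And>k. linear (f k)"
  shows "infinite_dimensional {x \<in> W. \<forall>k<n. f k x = 0}"
proof (induction n)
  case 0
  then show ?case using W by simp
next
  case (Suc n)
  let ?K = "\<lambda>n. {x \<in> W. \<forall>k<n. f k x = 0}"
  have sub: "subspace (?K n)"
    using W(1) by (auto simp: subspace_def linear_0[OF f] linear_add[OF f] linear_scale[OF f])
  show ?case
  proof (cases "\<exists>w \<in> ?K n. f n w \<noteq> 0")
    case False
    then have "?K (Suc n) = ?K n"
      by (auto simp: less_Suc_eq)
    with Suc show ?thesis by simp
  next
    case True
    then obtain w where w: "w \<in> ?K n" "f n w \<noteq> 0" by blast
    have "\<not> (finite S \<and> span S = ?K (Suc n))" for S
    proof
      assume S: "finite S \<and> span S = ?K (Suc n)"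
      have "x \<in> span (insert w S)" if x: "x \<in> ?K n" for x
      proof -
        \<comment> \<open>Subtracting \<open>c *\<^sub>R w\<close> projects \<open>x\<close> along
          \<open>w\<close> onto the kernel of \<open>f n\<close>.\<close>
        define c where "c = f n x / f n w"
        have "x - c *\<^sub>R w \<in> ?K n"
          using sub w(1) x by (simp only: subspace_diff subspace_scale)
        moreover have "f n (x - c *\<^sub>R w) = 0"
          using w(2) by (simp add: c_def linear_diff[OF f] linear_scale[OF f])
        ultimately have "x - c *\<^sub>R w \<in> span S"
          using S by (auto simp: less_Suc_eq)
        then show ?thesis
          by (auto simp: span_insert)
      qed
      moreover have "S \<subseteq> ?K (Suc n)"
        using S span_superset by blast
      then have "insert w S \<subseteq> ?K n"
        using w(1) by auto
      then have "span (insert w S) \<subseteq> ?K n"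
        using sub by (rule span_minimal)
      ultimately have "span (insert w S) = ?K n" by blast
      with Suc S show False
        unfolding infinite_dimensional_def by (meson finite_insert)
    qed
    then show ?thesis
      unfolding infinite_dimensional_def by blast
  qed
qed

lemma infinite_dimensional_not_zero:
  assumes "infinite_dimensional W" "0 \<in> W"
  obtains x where "x \<in> W" "x \<noteq> 0"
  using assms span_empty unfolding infinite_dimensional_def
  by (metis finite.emptyI insertI1 singletonD subset_antisym subsetI insert_subset empty_subsetI)

lemma infinite_dimensional_linear_image:
  assumes f: "linear f" "inj f"
  shows "infinite_dimensional (f ` W) \<longleftrightarrow> infinite_dimensional W"
proof -
  have "(\<exists>S. finite S \<and> span S = f ` W) \<longleftrightarrow> (\<exists>S. finite S \<and> span S = W)"
  proof
    assume "\<exists>S. finite S \<and> span S = f ` W"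
    then obtain S where S: "finite S" "span S = f ` W" by blast
    then obtain T where T: "finite T" "S = f ` T"
      by (metis finite_subset_image span_superset)
    then have "f ` span T = f ` W"
      using S(2) by (simp add: linear_span_image[OF f(1)])
    then show "\<exists>S. finite S \<and> span S = W"
      using T(1) f(2) by (metis inj_image_eq_iff)
  next
    assume "\<exists>S. finite S \<and> span S = W"
    then show "\<exists>S. finite S \<and> span S = f ` W"
      by (metis finite_imageI linear_span_image[OF f(1)])
  qed
  then show ?thesis
    unfolding infinite_dimensional_def by simp
qed

section \<open>Coordinates and humps in \<open>ell1\<close>\<close>

lemma linear_ell1_nth: "linear (\<lambda>x. ell1_nth x k)"
  by (rule linearI) (simp_all add: plus_ell1.rep_eq scaleR_ell1.rep_eq)

text \<open>The unit vectors are independent: all but \<open>e k\<close> lie in the hyperplane where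
  coordinate \<open>k\<close> vanishes.\<close>

lemma infinite_dimensional_ell1: "infinite_dimensional (UNIV :: ell1 set)"
proof -
  define e where "e k = Abs_ell1 (\<lambda>j. if j = k then 1 else 0)" for k
  have e: "ell1_nth (e k) j = (if j = k then 1 else 0)" for k j
  proof -
    have "summable (\<lambda>j. \<bar>if j = k then 1 else 0 :: real\<bar>)"
      by (rule summable_finite[of "{k}"]) auto
    then show ?thesis
      by (simp add: e_def Abs_ell1_inverse)
  qed
  have "inj e"
    by (rule injI) (metis e zero_neq_one)
  have "independent (range e)"
    unfolding dependent_def
  proof safe
    fix k assume "e k \<in> span (range e - {e k})"
    moreover have "span (range e - {e k}) \<subseteq> {x. ell1_nth x k = 0}"
    proof (rule span_minimal)
      show "subspace {x. ell1_nth x k = 0}"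
        using linear_subspace_vimage[OF linear_ell1_nth subspace_single_0] by (simp add: vimage_def)
    qed (auto simp: e)
    ultimately show False by (auto simp: e)
  qed
  then have "\<not> (finite S \<and> span S = UNIV)" for S :: "ell1 set"
    using independent_span_bound[of S "range e"] range_inj_infinite[OF \<open>inj e\<close>] by auto
  then show ?thesis
    unfolding infinite_dimensional_def by blast
qed

lemma ell1_tail_small:
  assumes "\<epsilon> > 0"
  obtains N where "(\<Sum>k. \<bar>ell1_nth x (k + N)\<bar>) < \<epsilon>"
proof -
  obtain N where "norm (\<Sum>k. \<bar>ell1_nth x (k + n)\<bar>) < \<epsilon>" if "n \<ge> N" for n
    using suminf_exist_split[OF assms summable_ell1[of x]] by blast
  then show thesis
    using that[of N] by force
qed

text \<open>The sup bound \<open>2\<close> reproduces itself: the summand \<open>y\<close> added in each step vanishes where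
  \<open>x\<close> may be large, and beyond that \<open>\<bar>x\<^sub>k\<bar> < 1/4\<close> while \<open>\<bar>y\<^sub>k\<bar> \<le> 1\<close>.\<close>
lemma gliding_hump:
  assumes W: "subspace W" "infinite_dimensional W"
  shows "\<exists>x\<in>W. real n / 2 \<le> norm x \<and> (\<forall>k. \<bar>ell1_nth x k\<bar> \<le> 2)"
proof (induction n)
  case 0
  show ?case
    by (rule bexI[of _ 0]) (auto simp: zero_ell1.rep_eq subspace_0[OF W(1)])
next
  case (Suc n)
  then obtain x where x: "x \<in> W" "real n / 2 \<le> norm x" "\<And>k. \<bar>ell1_nth x k\<bar> \<le> 2"
    by blast
  obtain N where N: "(\<Sum>k. \<bar>ell1_nth x (k + N)\<bar>) < 1/4"
    using ell1_tail_small[of "1/4" x] by auto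
  let ?K = "{y \<in> W. \<forall>k<N. ell1_nth y k = 0}"
  have "infinite_dimensional ?K"
    by (rule infinite_dimensional_kernel[OF W linear_ell1_nth])
  then obtain w where w: "w \<in> ?K" "w \<noteq> 0"
    by (rule infinite_dimensional_not_zero) (auto simp: zero_ell1.rep_eq subspace_0[OF W(1)])
  define y where "y = (1 / norm w) *\<^sub>R w"
  have y: "y \<in> W" "\<And>k. k < N \<Longrightarrow> ell1_nth y k = 0" "norm y = 1"
    using w by (auto simp: y_def scaleR_ell1.rep_eq subspace_scale[OF W(1)])
  have tail: "summable (\<lambda>k. \<bar>ell1_nth z (k + N)\<bar>)" for z
    by (rule summable_ignore_initial_segment[OF summable_ell1])
  have split: "norm z = (\<Sum>k<N. \<bar>ell1_nth z k\<bar>) + (\<Sum>k. \<bar>ell1_nth z (k + N)\<bar>)" for z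
    using suminf_split_initial_segment[OF summable_ell1, of z N] by (simp add: norm_ell1.rep_eq)
  have "(\<Sum>k. \<bar>ell1_nth y (k + N)\<bar>) \<le> (\<Sum>k. \<bar>ell1_nth (x + y) (k + N)\<bar> + \<bar>ell1_nth x (k + N)\<bar>)"
    by (intro suminf_le summable_add tail) (auto simp: plus_ell1.rep_eq)
  also have "\<dots> = (\<Sum>k. \<bar>ell1_nth (x + y) (k + N)\<bar>) + (\<Sum>k. \<bar>ell1_nth x (k + N)\<bar>)"
    by (rule suminf_add[symmetric]) (rule tail)+
  \<comment> \<open>The head of \<open>x\<close> is untouched; on the tail, \<open>y\<close>
    contributes 1, and the tail of \<open>x\<close> costs less than 1/4 twice: once by cancellation,
    once because it is part of \<open>norm x\<close>.\<close>
  finally have "norm x + 1/2 \<le> norm (x + y)"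
    using N y(2,3) split[of x] split[of y] split[of "x + y"] by (simp add: plus_ell1.rep_eq)
  moreover have "\<bar>ell1_nth (x + y) k\<bar> \<le> 2" for k
  proof (cases "k < N")
    case True
    then show ?thesis using x(3)[of k] y(2)[of k] by (simp add: plus_ell1.rep_eq)
  next
    case False
    then have "\<bar>ell1_nth x k\<bar> = (\<Sum>j\<in>{k - N}. \<bar>ell1_nth x (j + N)\<bar>)" by simp
    also have "\<dots> \<le> (\<Sum>k. \<bar>ell1_nth x (k + N)\<bar>)"
      by (rule sum_le_suminf[OF tail]) auto
    finally show ?thesis
      using N abs_ell1_nth_le_norm[of y k] y(3) by (simp add: plus_ell1.rep_eq)
  qed
  moreover have "x + y \<in> W"
    using x(1) y(1) by (rule subspace_add[OF W(1)])
  ultimately show ?case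
    using x(2) by (intro bexI[of _ "x + y"]) auto
qed

section \<open>The embedding of \<open>ell1\<close> into the Hilbert space\<close>

context
  fixes u :: "nat \<Rightarrow> 'x::{real_inner, banach}"
  assumes u: "orthonormal_basis u"
begin

text \<open>With \<open>'x\<close> identified with the square summable sequences through
  \<open>u\<close>, this is the inclusion of \<open>ell1\<close>.\<close>

definition synth :: "ell1 \<Rightarrow> 'x"
  where "synth x = (\<Sum>k. ell1_nth x k *\<^sub>R u k)"

lemma inner_u: "u i \<bullet> u j = (if i = j then 1 else 0)"
  using u by (simp add: orthonormal_basis_def)

lemma synth_sums: "(\<lambda>k. ell1_nth x k *\<^sub>R u k) sums synth x"
  unfolding synth_def by (rule summable_sums[OF summable_ell1_orthonormal_basis[OF u]])

text \<open>Continuity of the inner product allows termwise evaluation. Coordinates thus become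
  functionals on \<open>'x\<close>, which yields injectivity and expresses the \<open>ell1\<close>
  norm through Hilbert space elements.\<close>

lemma inner_synth: "synth x \<bullet> u k = ell1_nth x k"
proof -
  have "(\<lambda>j. (ell1_nth x j *\<^sub>R u j) \<bullet> u k) sums (synth x \<bullet> u k)"
    by (rule bounded_linear.sums[OF bounded_linear_inner_left synth_sums])
  moreover have "(\<lambda>j. (ell1_nth x j *\<^sub>R u j) \<bullet> u k) = (\<lambda>j. if j = k then ell1_nth x j else 0)"
    by (auto simp: inner_u)
  ultimately have "(\<lambda>j. if j = k then ell1_nth x j else 0) sums (synth x \<bullet> u k)"
    by simp
  then show ?thesis
    using sums_single[of k "ell1_nth x"] by (rule sums_unique2)
qed

lemma inj_synth: "inj synth"
proof (rule injI, rule ell1_eqI)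
  fix x y k
  assume "synth x = synth y"
  then show "ell1_nth x k = ell1_nth y k"
    using inner_synth[of x k] inner_synth[of y k] by simp
qed

lemma linear_synth: "linear synth"
proof (rule linearI)
  show "synth (x + y) = synth x + synth y" for x y
    using sums_add[OF synth_sums synth_sums, of x y]
    by (intro sums_unique2[OF synth_sums]) (simp add: plus_ell1.rep_eq scaleR_add_left)
  show "synth (c *\<^sub>R x) = c *\<^sub>R synth x" for c x
    using sums_scaleR_right[OF synth_sums, of c x]
    by (intro sums_unique2[OF synth_sums]) (simp add: scaleR_ell1.rep_eq)
qed

text \<open>Pythagoras on partial sums, where each square is at most \<open>b\<close> times the
  absolute value; then pass to the limit.\<close>

lemma norm_synth_sq_le:
  assumes "\<And>k. \<bar>ell1_nth x k\<bar> \<le> b"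
  shows "(norm (synth x))\<^sup>2 \<le> b * norm x"
proof (rule LIMSEQ_le_const2)
  show "(\<lambda>n. (norm (\<Sum>k<n. ell1_nth x k *\<^sub>R u k))\<^sup>2) \<longlonglongrightarrow> (norm (synth x))\<^sup>2"
    using synth_sums[of x] unfolding sums_def by (intro tendsto_intros)
  have "(norm (\<Sum>k<n. ell1_nth x k *\<^sub>R u k))\<^sup>2 \<le> b * norm x" for n
  proof -
    have "0 \<le> b" using assms[of 0] by linarith
    have "(norm (\<Sum>k<n. ell1_nth x k *\<^sub>R u k))\<^sup>2 = (\<Sum>k<n. (norm (ell1_nth x k *\<^sub>R u k))\<^sup>2)"
      by (intro norm_sum_Pythagorean) (auto simp: pairwise_def orthogonal_def inner_u)
    also have "\<dots> = (\<Sum>k<n. \<bar>ell1_nth x k\<bar> * \<bar>ell1_nth x k\<bar>)"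
      by (intro sum.cong refl) (simp add: norm_eq_sqrt_inner inner_u power2_eq_square)
    also have "\<dots> \<le> (\<Sum>k<n. b * \<bar>ell1_nth x k\<bar>)"
      by (intro sum_mono mult_right_mono assms) auto
    also have "\<dots> \<le> b * norm x"
      using sum_abs_le_norm_ell1[of x n] \<open>0 \<le> b\<close>
      by (simp add: mult_left_mono flip: sum_distrib_left)
    finally show ?thesis .
  qed
  then show "\<exists>N. \<forall>n\<ge>N. (norm (\<Sum>k<n. ell1_nth x k *\<^sub>R u k))\<^sup>2 \<le> b * norm x"
    by blast
qed

lemma bounded_linear_synth: "bounded_linear synth"
proof -
  have "norm (synth x) \<le> norm x * 1" for x
    using norm_synth_sq_le[OF abs_ell1_nth_le_norm]
    by (simp add: power2_le_imp_le power2_eq_square[of "norm x"])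
  then show ?thesis
    by (rule bounded_linear_intro[OF linear_add[OF linear_synth] linear_scale[OF linear_synth]])
qed

lemma range_synth_no_closed_infinite_dimensional_subspace:
  assumes U: "subspace U" "closed U" "U \<subseteq> range synth"
  shows "\<not> infinite_dimensional U"
proof
  assume "infinite_dimensional U"
  define W where "W = synth -` U"
  have "synth ` W = U"
    using U(3) by (auto simp: W_def)
  with \<open>infinite_dimensional U\<close> have W: "infinite_dimensional W"
    using infinite_dimensional_linear_image[OF linear_synth inj_synth] by metis
  have "subspace W"
    unfolding W_def by (rule linear_subspace_vimage[OF linear_synth U(1)])
  \<comment> \<open>Truncations of the \<open>ell1\<close> norm are finite and continuous on all of
    \<open>'x\<close>; on \<open>U\<close> they are bounded pointwise because \<open>U\<close> lies
    in the range of \<open>synth\<close>.\<close>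
  define p where "p m z = (\<Sum>k<m. \<bar>z \<bullet> u k\<bar>)" for m z
  have p_le: "p m (synth x) \<le> norm x" for m x
    by (simp add: p_def inner_synth sum_abs_le_norm_ell1)
  have cont: "continuous_on U (p m)" for m
    unfolding p_def by (intro continuous_intros)
  have triangle: "p m (x + y) \<le> p m x + p m y" for m x y
    unfolding p_def sum.distrib[symmetric] by (intro sum_mono) (simp add: inner_add_left abs_triangle_ineq)
  have scale: "p m (c *\<^sub>R x) = \<bar>c\<bar> * p m x" for m c x
    by (simp add: p_def abs_mult sum_distrib_left)
  have bdd: "bdd_above (range (\<lambda>m. p m z))" if z: "z \<in> U" for z
  proof -
    obtain x where "z = synth x" using U(3) z by blast
    then show ?thesis using p_le by (intro bdd_aboveI[of _ "norm x"]) auto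
  qed
  obtain C where C: "\<And>m z. z \<in> U \<Longrightarrow> p m z \<le> C * norm z"
    by (rule uniform_boundedness_on_subspace[of U p, OF U(1,2) cont triangle scale bdd]) (assumption, erule that)
  have norm_le: "norm x \<le> C * norm (synth x)" if "x \<in> W" for x
  proof -
    have "(\<Sum>k<m. \<bar>ell1_nth x k\<bar>) \<le> C * norm (synth x)" for m
      using C[of "synth x" m] that by (simp add: W_def p_def inner_synth)
    then show ?thesis
      unfolding norm_ell1.rep_eq by (rule suminf_le_const[OF summable_ell1])
  qed
  \<comment> \<open>The sup bound 2 will force \<open>norm x\<close> to be at most
    \<open>2 * C\<^sup>2\<close>, whereas the hump has norm at least
    \<open>real n / 2\<close>.\<close>
  obtain n :: nat where n: "2 * (2 * C\<^sup>2) < real n"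
    using reals_Archimedean2 by blast
  obtain x where x: "x \<in> W" "real n / 2 \<le> norm x" "\<And>k. \<bar>ell1_nth x k\<bar> \<le> 2"
    using gliding_hump[OF \<open>subspace W\<close> W] by blast
  have "norm x > 2 * C\<^sup>2" using n x(2) by linarith
  then have pos: "norm x > 0" by (smt (verit) zero_le_power2)
  have "(norm x)\<^sup>2 \<le> (C * norm (synth x))\<^sup>2"
    using norm_le[OF x(1)] by (rule power_mono) simp
  also have "\<dots> = C\<^sup>2 * (norm (synth x))\<^sup>2"
    by (rule power_mult_distrib)
  also have "\<dots> \<le> C\<^sup>2 * (2 * norm x)"
    by (intro mult_left_mono norm_synth_sq_le x(3)) simp
  finally have "norm x \<le> 2 * C\<^sup>2"
    using pos by (simp add: power2_eq_square)
  with \<open>norm x > 2 * C\<^sup>2\<close> show False by simp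
qed

end

section \<open>Transfer to the operator \<open>A\<close>\<close>

theorem proposition4p6:
  fixes u :: "nat \<Rightarrow> 'x::{real_inner, banach}"
    and At :: "'x \<Rightarrow> 'y::banach"
    and A :: "ell1 \<Rightarrow> 'y"
  assumes "infinite_dimensional (UNIV :: 'x set)"
    and "separable_space (euclidean :: 'x topology)"
    and "orthonormal_basis u"
    and "infinite_dimensional (UNIV :: 'y set)"
    and "bounded_linear At" and "inj At"
    and "\<And>x. A x = At (\<Sum>k. ell1_nth x k *\<^sub>R u k)"
  shows "ill_posed_type_II A"
proof -
  note u = assms(3) and At = assms(5,6)
  have A: "A = At \<circ> synth u"
    using assms(7) by (auto simp: synth_def[OF u])
  have bl: "bounded_linear A"
    unfolding A comp_def by (rule bounded_linear_compose[OF At(1) bounded_linear_synth[OF u]])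
  have inj: "inj A"
    unfolding A by (rule inj_compose[OF At(2) inj_synth[OF u]])
  have no_V: "\<not> infinite_dimensional V" if V: "V \<subseteq> range A" "subspace V" "closed V" for V
  proof -
    have lin: "linear At" using At(1) by (rule bounded_linear.linear)
    \<comment> \<open>Injectivity of \<open>At\<close> is essential here: a preimage of
      \<open>A x\<close> can only be \<open>synth u x\<close>.\<close>
    have "At -` V \<subseteq> range (synth u)"
      using V(1) At(2) by (force simp: A inj_eq)
    moreover have "subspace (At -` V)"
      using lin V(2) by (rule linear_subspace_vimage)
    moreover have "closed (At -` V)"
      using V(3) bounded_linear.continuous_on[OF At(1) continuous_on_id]
      by (intro closed_vimage) auto
    ultimately have "\<not> infinite_dimensional (At -` V)"
      by (intro range_synth_no_closed_infinite_dimensional_subspace[OF u])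
    moreover have "At ` (At -` V) = V"
      using V(1) by (auto simp: A)
    ultimately show ?thesis
      using infinite_dimensional_linear_image[OF lin At(2), of "At -` V"] by simp
  qed
  have lin: "linear A" using bl by (rule bounded_linear.linear)
  have "infinite_dimensional (range A)"
    using infinite_dimensional_linear_image[OF lin inj] infinite_dimensional_ell1 by blast
  moreover have "subspace (range A)"
    by (rule linear_subspace_image[OF lin subspace_UNIV])
  ultimately have "\<not> closed (range A)"
    using no_V by blast
  then have "ill_posed A"
    using assms(4) infinite_dimensional_ell1 bl inj
    by (simp add: ill_posed_def injective_operator_def)
  then show ?thesis
    using no_V by (auto simp: ill_posed_type_II_def ill_posed_type_I_def)
qed

end
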